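(* The harmonic maps $f:\mathbb{C}\to\mathbb{R}^3$, $f(z)=\operatorname{Re}\int^z(\omega_1,\omega_2,\omega_3)$, given by $$\omega_1=dz,\qquad \omega_2=z\,dz,\qquad \omega_3=\left(z^{n}+i\right)dz,\qquad n\ge 2 \text{ an integer},$$ and by $$\omega_1=i\,dz,\qquad \omega_2=iz\,dz,\qquad \omega_3=\left(z^{2n}+1\right)dz,\qquad n\ge 1 \text{ an integer},$$ are regular proper embeddings.
   Context: A map is regular if it is an immersion. A regular proper embedding is a proper injective immersion. The integral is taken from a fixed base point in $\mathbb{C}$. *)

theory Defs
  imports "HOL-Complex_Analysis.Cauchy_Integral_Theorem"
begin

(* C^k maps on the whole space, via iterated directional derivatives. The derivative in every
   direction v being of class C^k is, in finite dimension, the same as the Frechet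
   derivative being of class C^k. *)
primrec Ck_map :: "nat \<Rightarrow> ('a::euclidean_space \<Rightarrow> 'b::euclidean_space) \<Rightarrow> bool" where
  "Ck_map 0 f \<longleftrightarrow> continuous_on UNIV f"
| "Ck_map (Suc k) f \<longleftrightarrow>
     f differentiable_on UNIV \<and> (\<forall>v. Ck_map k (\<lambda>x. frechet_derivative f (at x) v))"

definition smooth_map :: "('a::euclidean_space \<Rightarrow> 'b::euclidean_space) \<Rightarrow> bool" where
  "smooth_map f \<longleftrightarrow> (\<forall>k. Ck_map k f)"

definition laplacian :: "('a::euclidean_space \<Rightarrow> 'b::euclidean_space) \<Rightarrow> 'a \<Rightarrow> 'b" where
  "laplacian f x =
     (\<Sum>b\<in>Basis. frechet_derivative (\<lambda>y. frechet_derivative f (at y) b) (at x) b)"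

definition harmonic_map :: "('a::euclidean_space \<Rightarrow> 'b::euclidean_space) \<Rightarrow> bool" where
  "harmonic_map f \<longleftrightarrow> Ck_map 2 f \<and> (\<forall>x. laplacian f x = 0)"

definition immersion :: "('a::euclidean_space \<Rightarrow> 'b::euclidean_space) \<Rightarrow> bool" where
  "immersion f \<longleftrightarrow> smooth_map f \<and> (\<forall>x. inj (frechet_derivative f (at x)))"

definition regular_proper_embedding ::
    "('a::euclidean_space \<Rightarrow> 'b::euclidean_space) \<Rightarrow> bool" where
  "regular_proper_embedding f \<longleftrightarrow> immersion f \<and> inj f \<and> proper_map euclidean euclidean f"

lemma proper_map_euclidean_iff_compact_vimage:
  fixes f :: "'a::euclidean_space \<Rightarrow> 'b::euclidean_space"
  assumes "continuous_on UNIV f"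
  shows "proper_map euclidean euclidean f \<longleftrightarrow> (\<forall>K. compact K \<longrightarrow> compact (f -` K))"
proof
  assume "proper_map euclidean euclidean f"
  then show "\<forall>K. compact K \<longrightarrow> compact (f -` K)"
    by (simp add: proper_map_alt vimage_def)
next
  assume f: "\<forall>K. compact K \<longrightarrow> compact (f -` K)"
  have S: "closed S" if S: "\<And>K. compact K \<Longrightarrow> compact (S \<inter> K)" for S :: "'b set"
  proof -
    have "l \<in> S" if x: "\<forall>n. x n \<in> S" "x \<longlonglongrightarrow> l" for x l
    proof -
      obtain r where "\<forall>n. norm (x n) \<le> r"
        using convergent_imp_Bseq[of x] x(2) by (auto simp: convergent_def Bseq_def)
      then have "\<forall>n. x n \<in> S \<inter> cball 0 r" using x(1) by simp
      then have "l \<in> S \<inter> cball 0 r"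
        using compact_imp_closed[OF S[OF compact_cball]] x(2) by (metis closed_sequential_limits)
      then show ?thesis by simp
    qed
    then show ?thesis by (auto simp: closed_sequential_limits)
  qed
  show "proper_map euclidean euclidean f"
    by (rule compact_imp_proper_map_gen) (use S f assms in \<open>auto simp: vimage_def\<close>)
qed

(* re_integral z0 g is the map z |-> Re (int_{z0}^z (g_1, ..., g_n) dw), the integral being taken
   along the segment from z0 to z; for entire g every path gives the same value, see below. *)
definition re_integral :: "complex \<Rightarrow> (complex \<Rightarrow> complex ^ 'n) \<Rightarrow> complex \<Rightarrow> real ^ 'n" where
  "re_integral z0 g z = (\<chi> j. Re (contour_integral (linepath z0 z) (\<lambda>w. g w $ j)))"

lemma re_integral_path:
  fixes g :: "complex \<Rightarrow> complex ^ 'n"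
  assumes "\<And>j. (\<lambda>w. g w $ j) holomorphic_on UNIV"
    and "valid_path p" "pathstart p = z0" "pathfinish p = z"
  shows "re_integral z0 g z = (\<chi> j. Re (contour_integral p (\<lambda>w. g w $ j)))"
proof -
  have "contour_integral (linepath z0 z) (\<lambda>w. g w $ j) = contour_integral p (\<lambda>w. g w $ j)" for j
  proof -
    obtain h where h: "\<And>x. x \<in> UNIV \<Longrightarrow> (h has_field_derivative g x $ j) (at x within UNIV)"
      using holomorphic_convex_primitive'[OF convex_UNIV open_UNIV assms(1)] by metis
    have "((\<lambda>w. g w $ j) has_contour_integral (h z - h z0)) q"
      if "valid_path q" "pathstart q = z0" "pathfinish q = z" for q
      using contour_integral_primitive[OF h that(1)] that by simp
    from this[of p] this[of "linepath z0 z"] assms show ?thesis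
      by (simp add: contour_integral_unique)
  qed
  then show ?thesis by (simp add: re_integral_def)
qed

end

theory Submission
  imports Defs "HOL-Complex_Analysis.Cauchy_Integral_Formula"
begin

text \<open>
  Every \<open>Re \<circ> F\<close> with \<open>F\<close> entire is smooth and harmonic, with differential \<open>v \<mapsto> Re (F' z * v)\<close>.
  Write \<open>z = x + iy\<close>. In the first family \<open>x\<close> and \<open>x\<^sup>2 - y\<^sup>2\<close> determine \<open>z\<close> up to conjugation and
  already control \<open>\<bar>z\<bar>\<close>; since \<open>Re (z ^ (n + 1))\<close> is even in \<open>y\<close>, the summand \<open>Re (i z) = -y\<close> of
  the third coordinate separates \<open>z\<close> from its conjugate. In the second family \<open>y\<close> and \<open>x y\<close>
  determine \<open>z\<close> off the real axis, on which the third coordinate is the strictly increasing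
  function \<open>x ^ (2 n + 1) / (2 n + 1) + x\<close>. If \<open>y\<close> and \<open>x y\<close> are bounded and \<open>x\<close> is large, then
  \<open>y = O(1 / x)\<close>, so \<open>Re (z ^ (2 n + 1))\<close> differs from \<open>x ^ (2 n + 1)\<close> by only \<open>O(x ^ (2 n - 1))\<close>
  and the third coordinate is large; this gives properness.
\<close>

section \<open>Smoothness and harmonicity of real parts of entire maps\<close>

lemma has_derivative_Re_vec:
  fixes F :: "'n::finite \<Rightarrow> complex \<Rightarrow> complex"
  assumes "\<And>j. (F j has_field_derivative F' j) (at z)"
  shows "((\<lambda>z. \<chi> j. Re (F j z)) has_derivative (\<lambda>v. \<chi> j. Re (F' j * v))) (at z)"
proof (subst has_derivative_componentwise_within, intro ballI)
  fix b :: "real ^ 'n"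
  assume "b \<in> Basis"
  then obtain j where b: "b = axis j 1"
    by (auto simp: Basis_vec_def)
  have "((\<lambda>z. Re (F j z)) has_derivative (\<lambda>v. Re (F' j * v))) (at z)"
    using assms[of j] by (intro has_derivative_Re) (simp add: has_field_derivative_def)
  then show "((\<lambda>z. (\<chi> j. Re (F j z)) \<bullet> b) has_derivative (\<lambda>v. (\<chi> j. Re (F' j * v)) \<bullet> b)) (at z)"
    by (simp add: b inner_axis)
qed

lemma frechet_derivative_Re_vec:
  fixes F :: "'n::finite \<Rightarrow> complex \<Rightarrow> complex"
  assumes "\<And>j. (F j has_field_derivative F' j) (at z)"
  shows "frechet_derivative (\<lambda>z. \<chi> j. Re (F j z)) (at z) = (\<lambda>v. \<chi> j. Re (F' j * v))"
  by (rule sym, rule frechet_derivative_at, rule has_derivative_Re_vec, rule assms)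

lemma frechet_derivative_Re_vec_holomorphic:
  fixes F :: "'n::finite \<Rightarrow> complex \<Rightarrow> complex"
  assumes "\<And>j. F j holomorphic_on UNIV"
  shows "frechet_derivative (\<lambda>z. \<chi> j. Re (F j z)) (at z) = (\<lambda>v. \<chi> j. Re (deriv (F j) z * v))"
  using assms by (intro frechet_derivative_Re_vec holomorphic_derivI) auto

text \<open>A directional derivative of such a map has the same form, with the entire functions
  \<open>\<lambda>z. deriv (F j) z * v\<close> in place of \<open>F j\<close>; hence the induction
  on \<open>k\<close> with \<open>F\<close> arbitrary.\<close>

lemma Ck_map_Re_vec:
  fixes F :: "'n::finite \<Rightarrow> complex \<Rightarrow> complex"
  assumes "\<And>j. F j holomorphic_on UNIV"
  shows "Ck_map k (\<lambda>z. \<chi> j. Re (F j z))"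
  using assms
proof (induction k arbitrary: F)
  case 0
  then show ?case
    by (auto intro!: continuous_intros holomorphic_on_imp_continuous_on)
next
  case (Suc k)
  have "((\<lambda>z. \<chi> j. Re (F j z)) has_derivative (\<lambda>v. \<chi> j. Re (deriv (F j) z * v))) (at z)" for z
    using Suc.prems by (intro has_derivative_Re_vec holomorphic_derivI) auto
  then have "(\<lambda>z. \<chi> j. Re (F j z)) differentiable (at z)" for z
    unfolding differentiable_def by blast
  moreover have "Ck_map k (\<lambda>z. \<chi> j. Re (deriv (F j) z * v))" for v
    using Suc.prems by (intro Suc.IH holomorphic_on_mult holomorphic_deriv holomorphic_on_const) auto
  ultimately show ?case
    using Suc.prems
    by (simp add: differentiable_on_def frechet_derivative_Re_vec_holomorphic)
qed

text \<open>The second derivative along \<open>b\<close> is \<open>Re (F'' * b * b)\<close>, and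
  over the basis \<open>{1, \<i>}\<close> the two contributions cancel because
  \<open>1 + \<i>\<^sup>2 = 0\<close>.\<close>

lemma harmonic_map_Re_vec:
  fixes F :: "'n::finite \<Rightarrow> complex \<Rightarrow> complex"
  assumes F: "\<And>j. F j holomorphic_on UNIV"
  shows "harmonic_map (\<lambda>z. \<chi> j. Re (F j z))"
proof -
  have "frechet_derivative (\<lambda>y. frechet_derivative (\<lambda>z. \<chi> j. Re (F j z)) (at y) b) (at z) b
      = (\<chi> j. Re (deriv (deriv (F j)) z * b * b))" for b z
  proof -
    have "((\<lambda>z. deriv (F j) z * b) has_field_derivative deriv (deriv (F j)) z * b) (at z)" for j
      using F by (intro DERIV_cmult_right holomorphic_derivI[of _ UNIV] holomorphic_deriv) auto
    then show ?thesis
      unfolding frechet_derivative_Re_vec_holomorphic[of F, OF F]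
      by (subst frechet_derivative_Re_vec) auto
  qed
  then show ?thesis
    using Ck_map_Re_vec[of F 2, OF F]
    by (simp add: harmonic_map_def laplacian_def Basis_complex_def vec_eq_iff)
qed

section \<open>Embedding criterion in terms of primitives\<close>

lemma re_integral_primitive:
  fixes g :: "complex \<Rightarrow> complex ^ 'n"
  assumes "\<And>j w. (F j has_field_derivative g w $ j) (at w)"
  shows "re_integral z0 g z = (\<chi> j. Re (F j z - F j z0))"
proof -
  have "((\<lambda>w. g w $ j) has_contour_integral (F j z - F j z0)) (linepath z0 z)" for j
    using contour_integral_primitive[of UNIV "F j" "\<lambda>w. g w $ j" "linepath z0 z"] assms by simp
  then have "contour_integral (linepath z0 z) (\<lambda>w. g w $ j) = F j z - F j z0" for j
    by (rule contour_integral_unique)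
  then show ?thesis
    by (simp add: re_integral_def)
qed

text \<open>Both families are reduced to three statements free of the base point: \<open>ker\<close>
  makes the differential injective, \<open>inj\<close> gives injectivity, and \<open>bdd\<close>
  gives properness, since preimages of compact sets are closed by continuity.\<close>

lemma harmonic_embedding_re_integral:
  fixes g :: "complex \<Rightarrow> complex ^ 'n"
  assumes F: "\<And>j w. (F j has_field_derivative g w $ j) (at w)"
    and ker: "\<And>z v. (\<And>j. Re (g z $ j * v) = 0) \<Longrightarrow> v = 0"
    and inj: "\<And>z w. (\<And>j. Re (F j z) = Re (F j w)) \<Longrightarrow> z = w"
    and bdd: "\<And>B. bounded {z. \<forall>j. \<bar>Re (F j z)\<bar> \<le> B}"
  shows "harmonic_map (re_integral z0 g) \<and> regular_proper_embedding (re_integral z0 g)"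
proof -
  define H where "H = (\<lambda>j z. F j z - F j z0)"
  define f where "f = (\<lambda>z. \<chi> j. Re (H j z))"
  have f: "re_integral z0 g = f"
    unfolding f_def H_def by (intro ext re_integral_primitive F)
  have dH: "(H j has_field_derivative g z $ j) (at z)" for j z
    unfolding H_def using DERIV_diff[OF F DERIV_const] by simp
  have holo: "H j holomorphic_on UNIV" for j
    using dH by (auto simp: holomorphic_on_open)
  have Ck: "Ck_map k f" for k
    unfolding f_def by (rule Ck_map_Re_vec) (rule holo)
  have harmonic: "harmonic_map f"
    unfolding f_def by (rule harmonic_map_Re_vec) (rule holo)
  have df: "frechet_derivative f (at z) = (\<lambda>v. \<chi> j. Re (g z $ j * v))" for z
    unfolding f_def by (rule frechet_derivative_Re_vec) (rule dH)
  have "inj (frechet_derivative f (at z))" for z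
  proof (rule injI)
    fix v w
    assume "frechet_derivative f (at z) v = frechet_derivative f (at z) w"
    then have "Re (g z $ j * (v - w)) = 0" for j
      unfolding df by (simp add: vec_eq_iff algebra_simps)
    then show "v = w"
      using ker by fastforce
  qed
  then have "immersion f"
    using Ck by (simp add: immersion_def smooth_map_def)
  moreover have "inj f"
    by (rule injI) (auto simp: f_def H_def vec_eq_iff intro: inj)
  moreover have "proper_map euclidean euclidean f"
  proof -
    have cont: "continuous_on UNIV f"
      using Ck[of 0] by simp
    have "compact (f -` K)" if "compact K" for K
    proof -
      obtain B where B: "norm y \<le> B" if "y \<in> K" for y
        using compact_imp_bounded[OF \<open>compact K\<close>] by (auto simp: bounded_iff)
      \<comment> \<open>\<open>f\<close> differs from the real part of \<open>F\<close> by the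
        constant \<open>Re (F j z0)\<close>; \<open>C\<close> bounds that shift for all
        \<open>j\<close> at once.\<close>
      define C where "C = (\<Sum>j\<in>UNIV. \<bar>Re (F j z0)\<bar>)"
      have "\<bar>Re (F j z)\<bar> \<le> B + C" if "f z \<in> K" for z j
      proof -
        have "\<bar>f z $ j\<bar> \<le> B"
          using B[OF that] component_le_norm_cart[of "f z" j] by linarith
        moreover have "\<bar>Re (F j z0)\<bar> \<le> C"
          unfolding C_def by (rule member_le_sum) auto
        ultimately show ?thesis
          by (simp add: f_def H_def)
      qed
      then have "bounded (f -` K)"
        by (intro bounded_subset[OF bdd[of "B + C"]]) auto
      moreover have "closed (f -` K)"
        using cont \<open>compact K\<close> by (intro closed_vimage) (auto simp: compact_imp_closed)
      ultimately show ?thesis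
        by (simp add: compact_eq_bounded_closed)
    qed
    with cont show ?thesis
      by (simp add: proper_map_euclidean_iff_compact_vimage)
  qed
  ultimately show ?thesis
    using harmonic by (simp add: f regular_proper_embedding_def)
qed

section \<open>Power functions\<close>

lemma has_field_derivative_power_Suc_div:
  "((\<lambda>z. z ^ Suc n / of_nat (Suc n)) has_field_derivative (z::complex) ^ n) (at z)"
proof -
  have "((\<lambda>z. z ^ Suc n) has_field_derivative of_nat (Suc n) * z ^ n) (at z)"
    by (auto intro!: derivative_eq_intros simp del: of_nat_Suc power_Suc)
  from DERIV_cdivide[OF this, of "of_nat (Suc n)"]
  show ?thesis
    by (simp del: of_nat_Suc power_Suc)
qed

lemma Re_power_cnj: "Re (cnj z ^ n) = Re (z ^ n)"
  by (metis complex_cnj_power cnj.simps(1))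

text \<open>The difference factors as \<open>z - w\<close> times a sum of \<open>Suc n\<close>
  monomials of degree \<open>n\<close>, each of norm at most \<open>r ^ n\<close>. It serves to
  compare a power of \<open>z\<close> with that of \<open>Re z\<close>.\<close>

lemma norm_power_diff_le:
  fixes z w :: complex and r :: real
  assumes "norm z \<le> r" "norm w \<le> r"
  shows "norm (z ^ Suc n - w ^ Suc n) \<le> norm (z - w) * (Suc n * r ^ n)"
proof -
  have "r \<ge> 0"
    using assms(1) norm_ge_zero order_trans by blast
  have "norm (\<Sum>i<Suc n. w ^ (n - i) * z ^ i) \<le> (\<Sum>i<Suc n. r ^ n)"
  proof (rule sum_norm_le)
    fix i assume "i \<in> {..<Suc n}"
    have "norm w ^ (n - i) * norm z ^ i \<le> r ^ (n - i) * r ^ i"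
      using assms \<open>r \<ge> 0\<close> by (intro mult_mono power_mono) auto
    also have "\<dots> = r ^ n"
      using \<open>i \<in> {..<Suc n}\<close> by (simp flip: power_add)
    finally show "norm (w ^ (n - i) * z ^ i) \<le> r ^ n"
      by (simp add: norm_mult norm_power)
  qed
  then have "norm (\<Sum>i<Suc n. w ^ (n - i) * z ^ i) \<le> Suc n * r ^ n"
    by (simp del: of_nat_Suc)
  moreover have "z ^ Suc n - w ^ Suc n = (z - w) * (\<Sum>i<Suc n. w ^ (n - i) * z ^ i)"
    using power_diff_sumr2[of z "Suc n" w] by (simp add: mult.commute)
  ultimately show ?thesis
    by (simp add: norm_mult mult_left_mono del: power_Suc of_nat_Suc)
qed

section \<open>The first family\<close>

lemma harmonic_embedding_first_family:
  fixes n :: nat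
  defines "g \<equiv> \<lambda>z. vector [1, z, z ^ n + \<i>] :: complex ^ 3"
  shows "harmonic_map (re_integral z0 g) \<and> regular_proper_embedding (re_integral z0 g)"
proof (rule harmonic_embedding_re_integral)
  define F where "F = (\<lambda>j z. (vector [z, z\<^sup>2 / 2, z ^ Suc n / of_nat (Suc n) + \<i> * z]
    :: complex ^ 3) $ j)"
  show "(F j has_field_derivative g w $ j) (at w)" for j w
  proof -
    have "((\<lambda>z. \<i> * z) has_field_derivative \<i>) (at w)"
      by (auto intro!: derivative_eq_intros)
    then have "((\<lambda>z. z ^ Suc n / of_nat (Suc n) + \<i> * z) has_field_derivative w ^ n + \<i>) (at w)"
      by (intro DERIV_add has_field_derivative_power_Suc_div)
    moreover have "((\<lambda>z. z\<^sup>2 / 2) has_field_derivative w) (at w)"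
      by (auto intro!: derivative_eq_intros)
    ultimately show ?thesis
      using exhaust_3[of j] by (auto simp: F_def g_def)
  qed
  show "v = 0" if "\<And>j. Re (g z $ j * v) = 0" for z v
  proof -
    from that[of 1] have v: "Re v = 0"
      by (simp add: g_def)
    with that[of 2] have "Im z = 0 \<or> Im v = 0"
      by (simp add: g_def)
    \<comment> \<open>For real \<open>z\<close> the power \<open>z ^ n\<close> is real, so for
      purely imaginary \<open>v\<close> the third condition reads \<open>- Im v = 0\<close>.\<close>
    moreover have "Im v = 0" if "Im z = 0"
    proof -
      have "z \<in> \<real>"
        using that by (simp add: complex_is_Real_iff)
      then have "Im (z ^ n) = 0"
        by (simp add: complex_is_Real_iff flip: complex_is_Real_iff)
      with \<open>\<And>j. Re (g z $ j * v) = 0\<close>[of 3] v show ?thesis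
        by (simp add: g_def)
    qed
    ultimately show ?thesis
      using v by (auto simp: complex_eq_iff)
  qed
  show "z = w" if eq: "\<And>j. Re (F j z) = Re (F j w)" for z w
  proof -
    have Re: "Re z = Re w"
      using eq[of 1] by (simp add: F_def)
    with eq[of 2] have "(Im z)\<^sup>2 = (Im w)\<^sup>2"
      by (simp add: F_def power2_eq_square)
    then consider "Im z = Im w" | "Im z = - Im w"
      by (auto simp: power2_eq_iff)
    then show ?thesis
    proof cases
      case 1
      with Re show ?thesis
        by (simp add: complex_eq_iff)
    next
      case 2
      with Re have "z = cnj w"
        by (simp add: complex_eq_iff)
      then have "Re (z ^ Suc n / of_nat (Suc n)) = Re (w ^ Suc n / of_nat (Suc n))"
        by (simp only: Re_divide_of_nat Re_power_cnj)
      with eq[of 3] have "Im z = Im w"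
        by (simp add: F_def del: power_Suc of_nat_Suc)
      with Re show ?thesis
        by (simp add: complex_eq_iff)
    qed
  qed
  show "bounded {z. \<forall>j. \<bar>Re (F j z)\<bar> \<le> B}" for B
  proof (rule boundedI)
    fix z
    assume "z \<in> {z. \<forall>j. \<bar>Re (F j z)\<bar> \<le> B}"
    then have "\<bar>Re (F 1 z)\<bar> \<le> B" "\<bar>Re (F 2 z)\<bar> \<le> B"
      by auto
    then have x: "\<bar>Re z\<bar> \<le> B" and "\<bar>(Re z)\<^sup>2 - (Im z)\<^sup>2\<bar> \<le> 2 * B"
      by (simp_all add: F_def power2_eq_square)
    moreover have "(Re z)\<^sup>2 \<le> B\<^sup>2"
      using power_mono[OF x, of 2] by simp
    \<comment> \<open>The left side is
      \<open>2 * (Re z)\<^sup>2 - ((Re z)\<^sup>2 - (Im z)\<^sup>2)\<close>.\<close>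
    ultimately have "(Re z)\<^sup>2 + (Im z)\<^sup>2 \<le> 2 * B\<^sup>2 + 2 * B"
      by linarith
    then show "norm z \<le> sqrt (2 * B\<^sup>2 + 2 * B)"
      by (simp add: cmod_def)
  qed
qed

section \<open>The second family\<close>

text \<open>The exponent \<open>m = 2 n + 3\<close> is that of the second family with \<open>n\<close> shifted by one, so that no
  truncated subtraction occurs.\<close>

lemma Re_bound_second_family:
  fixes n :: nat and z :: complex
  defines "m \<equiv> 2 * n + 3"
  assumes B: "\<bar>Im z\<bar> \<le> B" "\<bar>Re z * Im z\<bar> \<le> B" "\<bar>Re (z ^ m) / m + Re z\<bar> \<le> B"
  shows "(Re z)\<^sup>2 \<le> 1 + m * B + B * m * (1 + B) ^ (2 * n + 2)"
proof -
  define x where "x = Re z"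
  define K where "K = B * m * (1 + B) ^ (2 * n + 2)"
  have "B \<ge> 0"
    using B(1) by linarith
  have "K \<ge> 0"
    using \<open>B \<ge> 0\<close> by (simp add: K_def)
  \<comment> \<open>For small \<open>x\<close> the claim is immediate; otherwise
    \<open>\<bar>x\<bar> \<ge> 1\<close> and \<open>x\<^sup>2 - K \<ge> 0\<close>, which is what the
    final estimate needs.\<close>
  show ?thesis
  proof (cases "x\<^sup>2 \<le> 1 \<or> x\<^sup>2 \<le> K")
    case True
    then show ?thesis
      using \<open>B \<ge> 0\<close> \<open>K \<ge> 0\<close> unfolding x_def[symmetric] K_def[symmetric]
      by (auto intro: order_trans[of _ "1::real"] simp: add_increasing)
  next
    case False
    then have x1: "\<bar>x\<bar> \<ge> 1" and xK: "x\<^sup>2 \<ge> K"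
      using abs_square_le_1[of x] by auto
    have "norm z \<le> \<bar>x\<bar> + B"
      using cmod_le[of z] B(1) by (simp add: x_def)
    \<comment> \<open>A common radius for \<open>z\<close> and \<open>x\<close>, proportional to
      \<open>\<bar>x\<bar>\<close>, so that its powers split off powers of
      \<open>\<bar>x\<bar>\<close>.\<close>
    also have "\<dots> \<le> \<bar>x\<bar> * (1 + B)"
      using mult_right_mono[OF x1 \<open>B \<ge> 0\<close>] by (simp add: algebra_simps)
    finally have "norm z \<le> \<bar>x\<bar> * (1 + B)" .
    moreover have "norm (complex_of_real x) \<le> \<bar>x\<bar> * (1 + B)"
      using \<open>B \<ge> 0\<close> by (simp add: algebra_simps)
    ultimately have "norm (z ^ Suc (2 * n + 2) - of_real x ^ Suc (2 * n + 2))
        \<le> norm (z - of_real x) * (Suc (2 * n + 2) * (\<bar>x\<bar> * (1 + B)) ^ (2 * n + 2))"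
      by (rule norm_power_diff_le)
    moreover have "Suc (2 * n + 2) = m"
      by (simp add: m_def)
    moreover have "z - of_real x = \<i> * Im z"
      by (simp add: complex_eq_iff x_def)
    ultimately have "norm (z ^ m - of_real x ^ m)
        \<le> \<bar>Im z\<bar> * (m * (\<bar>x\<bar> * (1 + B)) ^ (2 * n + 2))"
      by (simp only: norm_mult norm_ii norm_of_real mult_1)
    moreover have "\<bar>Re (z ^ m) - x ^ m\<bar> \<le> norm (z ^ m - of_real x ^ m)"
      using abs_Re_le_cmod[of "z ^ m - of_real (x ^ m)"] by simp
    ultimately have "\<bar>Re (z ^ m) - x ^ m\<bar> \<le> \<bar>Im z\<bar> * (m * (\<bar>x\<bar> * (1 + B)) ^ (2 * n + 2))"
      by linarith
    \<comment> \<open>One factor \<open>\<bar>x\<bar>\<close> joins \<open>\<bar>Im z\<bar>\<close>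
      to form the bounded product, leaving degree \<open>m - 2\<close> in
      \<open>\<bar>x\<bar>\<close>.\<close>
    also have "\<dots> = \<bar>x * Im z\<bar> * (m * (1 + B) ^ (2 * n + 2) * \<bar>x\<bar> ^ (2 * n + 1))"
      by (simp add: power_mult_distrib abs_mult)
    also have "\<dots> \<le> B * (m * (1 + B) ^ (2 * n + 2) * \<bar>x\<bar> ^ (2 * n + 1))"
      using B(2) \<open>B \<ge> 0\<close> by (intro mult_right_mono) (auto simp: x_def)
    also have "\<dots> = K * \<bar>x\<bar> ^ (2 * n + 1)"
      by (simp add: K_def)
    finally have diff: "\<bar>Re (z ^ m) - x ^ m\<bar> \<le> K * \<bar>x\<bar> ^ (2 * n + 1)" .
    have "m > 0"
      by (simp add: m_def)
    \<comment> \<open>As an even power \<open>e\<close> is nonnegative, so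
      \<open>x ^ m = x * e\<close> and \<open>m * x\<close> have the same sign and cannot
      cancel.\<close>
    define e where "e = x ^ (2 * n + 2)"
    have "e \<ge> 0"
      unfolding e_def by (rule zero_le_even_power) simp
    have "m = Suc (2 * n + 2)"
      by (simp add: m_def)
    then have xm: "x ^ m = x * e"
      by (simp only: e_def power_Suc)
    then have "\<bar>x\<bar> ^ m = \<bar>x\<bar> * e"
      using \<open>e \<ge> 0\<close> by (simp add: abs_mult flip: power_abs)
    also have "\<dots> \<le> \<bar>x\<bar> * (e + m)"
      by (intro mult_left_mono) auto
    also have "\<dots> = \<bar>x * (e + m)\<bar>"
      using \<open>e \<ge> 0\<close> by (simp add: abs_mult)
    also have "x * (e + m) = x ^ m + m * x"
      by (simp add: xm algebra_simps)
    finally have low: "\<bar>x\<bar> ^ m \<le> \<bar>x ^ m + m * x\<bar>" .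
    have "m * (Re (z ^ m) / m + x) = Re (z ^ m) + m * x"
      using \<open>m > 0\<close> by (simp add: field_simps)
    then have "\<bar>Re (z ^ m) + m * x\<bar> = m * \<bar>Re (z ^ m) / m + x\<bar>"
      by (metis abs_mult abs_of_nat)
    also have "\<dots> \<le> m * B"
      using B(3) by (intro mult_left_mono) (auto simp: x_def)
    finally have "\<bar>x\<bar> ^ m \<le> m * B + K * \<bar>x\<bar> ^ (2 * n + 1)"
      using low diff by linarith
    moreover have "\<bar>x\<bar> ^ m = x\<^sup>2 * \<bar>x\<bar> ^ (2 * n + 1)"
      by (simp add: m_def numeral_eq_Suc)
    ultimately have "(x\<^sup>2 - K) * \<bar>x\<bar> ^ (2 * n + 1) \<le> m * B"
      by (simp add: left_diff_distrib)
    moreover have "(x\<^sup>2 - K) * 1 \<le> (x\<^sup>2 - K) * \<bar>x\<bar> ^ (2 * n + 1)"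
      using x1 xK by (intro mult_left_mono one_le_power) auto
    ultimately have "x\<^sup>2 - K \<le> m * B"
      by simp
    then show ?thesis
      unfolding x_def[symmetric] K_def[symmetric] by linarith
  qed
qed

lemma harmonic_embedding_second_family:
  fixes n :: nat
  assumes "n \<ge> 1"
  defines "g \<equiv> \<lambda>z. vector [\<i>, \<i> * z, z ^ (2 * n) + 1] :: complex ^ 3"
  shows "harmonic_map (re_integral z0 g) \<and> regular_proper_embedding (re_integral z0 g)"
proof (rule harmonic_embedding_re_integral)
  define F where "F = (\<lambda>j z. (vector [\<i> * z, \<i> * (z\<^sup>2 / 2),
    z ^ Suc (2 * n) / of_nat (Suc (2 * n)) + z] :: complex ^ 3) $ j)"
  show "(F j has_field_derivative g w $ j) (at w)" for j w
  proof -
    have "((\<lambda>z. z ^ Suc (2 * n) / of_nat (Suc (2 * n)) + z) has_field_derivative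
        w ^ (2 * n) + 1) (at w)"
      by (intro derivative_intros has_field_derivative_power_Suc_div)
    moreover have "((\<lambda>z. \<i> * (z\<^sup>2 / 2)) has_field_derivative \<i> * w) (at w)"
      by (auto intro!: derivative_eq_intros)
    moreover have "((\<lambda>z. \<i> * z) has_field_derivative \<i>) (at w)"
      by (auto intro!: derivative_eq_intros)
    ultimately show ?thesis
      using exhaust_3[of j] by (auto simp: F_def g_def)
  qed
  have F1: "Re (F 1 z) = - Im z" and F2: "Re (F 2 z) = - (Re z * Im z)"
    and F3: "Re (F 3 z) = Re (z ^ Suc (2 * n)) / Suc (2 * n) + Re z" for z
    by (simp_all add: F_def del: power_Suc of_nat_Suc) (simp add: power2_eq_square)
  show "v = 0" if "\<And>j. Re (g z $ j * v) = 0" for z v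
  proof -
    from that[of 1] have v: "Im v = 0"
      by (simp add: g_def)
    with that[of 2] have "Im z = 0 \<or> Re v = 0"
      by (simp add: g_def)
    \<comment> \<open>For real \<open>z\<close> the even power is nonnegative, so
      \<open>z ^ (2 * n) + 1\<close> is a positive real and the third condition forces the real
      vector \<open>v\<close> to vanish.\<close>
    moreover have "Re v = 0" if "Im z = 0"
    proof -
      have "z = of_real (Re z)"
        using that by (simp add: complex_eq_iff)
      then have "z ^ (2 * n) = of_real (Re z ^ (2 * n))"
        by (metis of_real_power)
      then have "Re (z ^ (2 * n)) \<ge> 0"
        by (simp add: power_mult)
      with \<open>\<And>j. Re (g z $ j * v) = 0\<close>[of 3] v show ?thesis
        by (auto simp: g_def)
    qed
    ultimately show ?thesis
      using v by (auto simp: complex_eq_iff)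
  qed
  show "z = w" if eq: "\<And>j. Re (F j z) = Re (F j w)" for z w
  proof -
    have Im: "Im z = Im w"
      using eq[of 1] by (simp add: F1)
    moreover have "Re z = Re w"
    proof (cases "Im w = 0")
      case False
      with eq[of 2] Im show ?thesis
        by (simp add: F2)
    next
      case True
      define h where "h = (\<lambda>x::real. x ^ Suc (2 * n) / Suc (2 * n) + x)"
      have "strict_mono h"
        unfolding h_def
        by (intro strict_monoI add_le_less_mono divide_right_mono power_mono_odd) auto
      have "Re (F 3 u) = h (Re u)" if "Im u = 0" for u
      proof -
        have "u = of_real (Re u)"
          using that by (simp add: complex_eq_iff)
        then have "Re (u ^ Suc (2 * n)) = Re u ^ Suc (2 * n)"
          by (metis of_real_power Re_complex_of_real)
        then show ?thesis
          by (simp only: F3 h_def)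
      qed
      with eq[of 3] True Im have "h (Re z) = h (Re w)"
        by simp
      with \<open>strict_mono h\<close> show ?thesis
        by (simp add: strict_mono_eq)
    qed
    ultimately show ?thesis
      by (simp add: complex_eq_iff)
  qed
  show "bounded {z. \<forall>j. \<bar>Re (F j z)\<bar> \<le> B}" for B
  proof (rule boundedI)
    fix z
    assume "z \<in> {z. \<forall>j. \<bar>Re (F j z)\<bar> \<le> B}"
    then have "\<bar>Re (F j z)\<bar> \<le> B" for j
      by auto
    from this[of 1] this[of 2] this[of 3]
    have B: "\<bar>Im z\<bar> \<le> B" "\<bar>Re z * Im z\<bar> \<le> B"
      "\<bar>Re (z ^ Suc (2 * n)) / Suc (2 * n) + Re z\<bar> \<le> B"
      by (simp_all only: F1 F2 F3 abs_minus_cancel)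
    \<comment> \<open>Since \<open>n \<ge> 1\<close> the subtraction is exact, and
      \<open>2 * n + 1\<close> becomes the exponent \<open>2 * k + 3\<close> of the bound on
      \<open>Re z\<close>.\<close>
    define k where "k = n - 1"
    then have k: "Suc (2 * n) = 2 * k + 3"
      using \<open>n \<ge> 1\<close> by simp
    define C where "C = 1 + (2 * k + 3 :: nat) * B + B * (2 * k + 3 :: nat) * (1 + B) ^ (2 * k + 2)"
    have "(Re z)\<^sup>2 \<le> C"
      unfolding C_def using B unfolding k by (rule Re_bound_second_family)
    moreover have "(Im z)\<^sup>2 \<le> B\<^sup>2"
      using power_mono[OF B(1), of 2] by simp
    ultimately show "norm z \<le> sqrt (C + B\<^sup>2)"
      by (simp add: cmod_def)
  qed
qed

theorem proposition3p1:
  fixes z0 :: complex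
  shows "(\<forall>n::nat. n \<ge> 2 \<longrightarrow>
            (let f = re_integral z0 (\<lambda>z. vector [1, z, z ^ n + \<i>] :: complex ^ 3)
             in harmonic_map f \<and> regular_proper_embedding f)) \<and>
         (\<forall>n::nat. n \<ge> 1 \<longrightarrow>
            (let f = re_integral z0 (\<lambda>z. vector [\<i>, \<i> * z, z ^ (2 * n) + 1] :: complex ^ 3)
             in harmonic_map f \<and> regular_proper_embedding f))"
  unfolding Let_def
  using harmonic_embedding_first_family harmonic_embedding_second_family by blast

end
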